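(* Let $W\in\mathbb{R}^{2n\times 2n}$ be a symmetric matrix, let $X^W\in\mathbb{C}^{n\times n}$ be the Hermitian matrix associated to $W$ (defined in the context), and for distinct $k,m\in\{1,\dots,n\}$ consider the $2\times 2$ principal submatrix $$X^W_{\{k,m\}}:=\begin{pmatrix}X^W_{kk}&\Re X^W_{km}+j\,\Im X^W_{km}\\ \Re X^W_{mk}+j\,\Im X^W_{mk}&X^W_{mm}\end{pmatrix}.$$ If $W\succeq 0$, then $X^W_{\{k,m\}}\succeq 0$, i.e. $X^W_{kk},X^W_{mm}\ge 0$ and $$(\Re X^W_{km})^2+(\Im X^W_{km})^2\le X^W_{kk}X^W_{mm}.$$ In particular, $$(W_{km}+W_{k'm'})^2+(W_{mk'}-W_{km'})^2\le(W_{kk}+W_{k'k'})(W_{mm}+W_{m'm'}).$$ Moreover, for any permutation $\sigma$ of the index set $\{k,m,k',m'\}$, $$c_\sigma^2+s_\sigma^2\le r_\sigma t_\sigma,$$ where $c_\sigma:=W_{\sigma(k)\sigma(m)}+W_{\sigma(k')\sigma(m')}$, $s_\sigma:=W_{\sigma(k)\sigma(m')}-W_{\sigma(m)\sigma(k')}$, $r_\sigma:=W_{\sigma(k)\sigma(k)}+W_{\sigma(k')\sigma(k')}$ and $t_\sigma:=W_{\sigma(m)\sigma(m)}+W_{\sigma(m')\sigma(m')}$.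
   Context: For $k\in\{1,\dots,n\}$ write $k':=n+k$, so the rows and columns of a $2n\times 2n$ matrix are indexed by $1,\dots,n,1',\dots,n'$. Given a symmetric matrix $W\in\mathbb{R}^{2n\times 2n}$, the Hermitian matrix $X^W\in\mathbb{C}^{n\times n}$ is defined by $$X^W_{kk}:=W_{kk}+W_{k'k'},\qquad \Re X^W_{km}:=W_{km}+W_{k'm'},\qquad \Im X^W_{km}:=W_{km'}-W_{mk'}\qquad(k\ne m).$$ Here $j$ is the imaginary unit, and $\succeq 0$ means positive semidefinite, over $\mathbb{R}$ for real symmetric matrices and over $\mathbb{C}$ for Hermitian matrices. *)

theory Defs
  imports
    "Jordan_Normal_Form.Schur_Decomposition"
    "HOL-Combinatorics.Permutations"
begin

(* For real matrices conjugate is the identity, so this is symmetry and v^T A v >= 0 for all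
   real v.  For complex matrices it is v^* A v >= 0 for all complex v, in the order of
   HOL-Library.Complex_Order: 0 \<le> z means that z is real and nonnegative. *)
definition psd_mat :: "'a :: conjugatable_ordered_field mat \<Rightarrow> bool" where
  "psd_mat A \<longleftrightarrow> square_mat A \<and> mat_adjoint A = A \<and>
     (\<forall>v \<in> carrier_vec (dim_row A). 0 \<le> (A *\<^sub>v v) \<bullet>c v)"

(* Indices are 0-based: k ranges over {..<n}, and k' is n + k. *)
definition herm_of :: "nat \<Rightarrow> real mat \<Rightarrow> complex mat" where
  "herm_of n W = mat n n (\<lambda>(k, m).
     if k = m then complex_of_real (W $$ (k, k) + W $$ (n + k, n + k))
     else Complex (W $$ (k, m) + W $$ (n + k, n + m)) (W $$ (k, n + m) - W $$ (m, n + k)))"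

(* The rows and columns come in the order k, m, also when m < k. *)
definition principal2 :: "'a mat \<Rightarrow> nat \<Rightarrow> nat \<Rightarrow> 'a mat" where
  "principal2 A k m = mat_of_rows_list 2
     [[A $$ (k, k), A $$ (k, m)],
      [A $$ (m, k), A $$ (m, m)]]"

lemma herm_of_hermitian:
  assumes W: "W \<in> carrier_mat (2 * n) (2 * n)" and sym: "W\<^sup>T = W"
  shows "mat_adjoint (herm_of n W) = herm_of n W"
proof -
  have s: "W $$ (i, j) = W $$ (j, i)" if "i < 2 * n" "j < 2 * n" for i j
    using W sym that by (metis carrier_matD index_transpose_mat(1))
  show ?thesis
  proof (rule eq_matI)
    fix i j assume "i < dim_row (herm_of n W)" "j < dim_col (herm_of n W)"
    then have ij: "i < n" "j < n" by (auto simp: herm_of_def)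
    have "W $$ (j, i) = W $$ (i, j)" "W $$ (n + j, n + i) = W $$ (n + i, n + j)"
      using ij by (auto intro: s)
    with ij show "mat_adjoint (herm_of n W) $$ (i, j) = herm_of n W $$ (i, j)"
      by (auto simp: mat_adjoint_def herm_of_def mat_of_rows_index complex_eq_iff)
  qed (auto simp: mat_adjoint_def herm_of_def)
qed

end

(* With a, b, c, d the images of k, m, k', m', the real quadratic form of W at the two vectors
   with entries (x1, x2, y1, y2) and (-y1, -y2, x1, x2) in these positions sums to the Hermitian
   form r |z1|^2 + t |z2|^2 + 2 (C Re (conj z1 * z2) + S Im (conj z1 * z2)) at z = x + j y.  Only
   the distinctness of the four indices matters, which gives every permutation at once; the
   inequality C^2 + S^2 \<le> r t is the discriminant condition for this form. *)
theory Submission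
  imports Defs
begin

text \<open>The test vector is \<open>f\<close> on \<open>S\<close> extended by zero, so every term
  of the full form with an index outside \<open>S\<close> vanishes. Summing over a set leaves the
  order of the indices open.\<close>

lemma psd_mat_quadratic_form_nonneg:
  fixes W :: "real mat" and f :: "nat \<Rightarrow> real"
  assumes psd: "psd_mat W" and S: "S \<subseteq> {..<dim_row W}"
  shows "0 \<le> (\<Sum>i\<in>S. \<Sum>j\<in>S. W $$ (i, j) * f i * f j)"
proof -
  define N where "N = dim_row W"
  define v where "v = vec N (\<lambda>i. if i \<in> S then f i else 0)"
  have dim: "dim_col W = N" and v: "v \<in> carrier_vec N"
    using psd by (auto simp: psd_mat_def N_def v_def)
  have "0 \<le> (W *\<^sub>v v) \<bullet>c v"
    using psd v by (auto simp: psd_mat_def N_def)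
  also have "(W *\<^sub>v v) \<bullet>c v = (\<Sum>i<N. \<Sum>j<N. W $$ (i, j) * v $ i * v $ j)"
    using v dim by (simp add: scalar_prod_def N_def[symmetric] sum_distrib_left sum_distrib_right
        atLeast0LessThan mult_ac)
  also have "\<dots> = (\<Sum>i\<in>S. \<Sum>j<N. W $$ (i, j) * v $ i * v $ j)"
    using S by (intro sum.mono_neutral_right) (auto simp: v_def N_def)
  also have "\<dots> = (\<Sum>i\<in>S. \<Sum>j\<in>S. W $$ (i, j) * v $ i * v $ j)"
    using S by (intro sum.cong sum.mono_neutral_right) (auto simp: v_def N_def)
  also have "\<dots> = (\<Sum>i\<in>S. \<Sum>j\<in>S. W $$ (i, j) * f i * f j)"
    using S by (intro sum.cong) (auto simp: v_def N_def subset_iff)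
  finally show ?thesis .
qed

lemma psd_mat_hermitian_form_nonneg:
  fixes W :: "real mat"
  assumes W: "W \<in> carrier_mat N N" and sym: "W\<^sup>T = W" and psd: "psd_mat W"
    and lt: "{a, b, c, d} \<subseteq> {..<N}" and dist: "distinct [a, b, c, d]"
  shows "0 \<le> (W $$ (a, a) + W $$ (c, c)) * (x1\<^sup>2 + y1\<^sup>2)
           + (W $$ (b, b) + W $$ (d, d)) * (x2\<^sup>2 + y2\<^sup>2)
           + 2 * ((W $$ (a, b) + W $$ (c, d)) * (x1 * x2 + y1 * y2)
                + (W $$ (a, d) - W $$ (b, c)) * (x1 * y2 - y1 * x2))"
proof -
  have s: "W $$ (i, j) = W $$ (j, i)" if "i < N" "j < N" for i j
    using W sym that by (metis carrier_matD index_transpose_mat(1))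
  have comm: "W $$ (b, a) = W $$ (a, b)" "W $$ (c, a) = W $$ (a, c)" "W $$ (d, a) = W $$ (a, d)"
    "W $$ (c, b) = W $$ (b, c)" "W $$ (d, b) = W $$ (b, d)" "W $$ (d, c) = W $$ (c, d)"
    using lt by (auto intro: s)
  \<comment> \<open>The form of \<open>W\<close> at the vector with entries \<open>p1\<close>,
    \<open>p2\<close>, \<open>p3\<close>, \<open>p4\<close> in positions \<open>a\<close>,
    \<open>b\<close>, \<open>c\<close>, \<open>d\<close>; by symmetry each off-diagonal pair is
    merged into one doubled term.\<close>
  define q where "q p1 p2 p3 p4 =
      W $$ (a, a) * p1\<^sup>2 + W $$ (b, b) * p2\<^sup>2 + W $$ (c, c) * p3\<^sup>2 + W $$ (d, d) * p4\<^sup>2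
      + 2 * (W $$ (a, b) * p1 * p2 + W $$ (a, c) * p1 * p3 + W $$ (a, d) * p1 * p4
           + W $$ (b, c) * p2 * p3 + W $$ (b, d) * p2 * p4 + W $$ (c, d) * p3 * p4)" for p1 p2 p3 p4
  have q_nonneg: "0 \<le> q p1 p2 p3 p4" for p1 p2 p3 p4
  proof -
    define f where "f = (\<lambda>_. 0 :: real)(a := p1, b := p2, c := p3, d := p4)"
    have f: "f a = p1" "f b = p2" "f c = p3" "f d = p4"
      using dist by (auto simp: f_def)
    have "0 \<le> (\<Sum>i\<in>{a, b, c, d}. \<Sum>j\<in>{a, b, c, d}. W $$ (i, j) * f i * f j)"
      using psd lt W by (intro psd_mat_quadratic_form_nonneg) auto
    also have "\<dots> = q p1 p2 p3 p4"
      using dist by (simp add: f comm q_def power2_eq_square algebra_simps)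
    finally show ?thesis .
  qed
  \<comment> \<open>The terms in \<open>W $$ (a, c)\<close> and \<open>W $$ (b, d)\<close> cancel in
    this sum, while those in \<open>W $$ (a, d)\<close> and \<open>W $$ (b, c)\<close> acquire the
    factor \<open>x1 * y2 - y1 * x2\<close> with opposite signs.\<close>
  have "0 \<le> q x1 x2 y1 y2 + q (- y1) (- y2) x1 x2"
    by (intro add_nonneg_nonneg q_nonneg)
  then show ?thesis
    by (simp add: q_def power2_eq_square algebra_simps)
qed

text \<open>Fixing the second variable at 1 and giving the first the phase that makes the cross term
  most negative reduces the form to a real quadratic in a scale \<open>l\<close>.\<close>

lemma discriminant_le_of_nonneg:
  fixes r t C S :: real
  assumes form: "\<And>x1 y1 x2 y2. 0 \<le> r * (x1\<^sup>2 + y1\<^sup>2) + t * (x2\<^sup>2 + y2\<^sup>2)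
      + 2 * (C * (x1 * x2 + y1 * y2) + S * (x1 * y2 - y1 * x2))"
  shows "0 \<le> r" "0 \<le> t" "C\<^sup>2 + S\<^sup>2 \<le> r * t"
proof -
  show r: "0 \<le> r" using form[of 1 0 0 0] by simp
  show t: "0 \<le> t" using form[of 0 0 1 0] by simp
  define D where "D = C\<^sup>2 + S\<^sup>2"
  \<comment> \<open>Here z1 = -l (C - j S) and z2 = 1, so |z1|^2 is \<open>l\<^sup>2 * D\<close> and
    the cross term is \<open>- 2 * l * D\<close>.\<close>
  have line: "0 \<le> r * l\<^sup>2 * D + t - 2 * l * D" for l
    using form[of "- l * C" "l * S" 1 0]
    by (simp add: D_def power2_eq_square algebra_simps)
  have "D \<le> r * t"
  proof (cases "r = 0")
    case True
    have "D = 0"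
    proof (rule ccontr)
      \<comment> \<open>With \<open>r = 0\<close> the bound is affine in \<open>l\<close>; the
        chosen \<open>l\<close> gives it the value -1.\<close>
      assume "D \<noteq> 0"
      then show False
        using line[of "(t + 1) / (2 * D)"] True by simp
    qed
    then show ?thesis using True by simp
  next
    case False
    \<comment> \<open>The minimizer \<open>l = 1 / r\<close> leaves
      \<open>0 \<le> t - D / r\<close>.\<close>
    then show ?thesis
      using line[of "1 / r"] r by (simp add: power2_eq_square field_simps)
  qed
  then show "C\<^sup>2 + S\<^sup>2 \<le> r * t" by (simp add: D_def)
qed

lemma psd_mat_imp_discriminant_le:
  fixes W :: "real mat"
  assumes "W \<in> carrier_mat N N" and "W\<^sup>T = W" and "psd_mat W"
    and "{a, b, c, d} \<subseteq> {..<N}" and "distinct [a, b, c, d]"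
  shows "0 \<le> W $$ (a, a) + W $$ (c, c)" "0 \<le> W $$ (b, b) + W $$ (d, d)"
    "(W $$ (a, b) + W $$ (c, d))\<^sup>2 + (W $$ (a, d) - W $$ (b, c))\<^sup>2
     \<le> (W $$ (a, a) + W $$ (c, c)) * (W $$ (b, b) + W $$ (d, d))"
  by (rule discriminant_le_of_nonneg[OF psd_mat_hermitian_form_nonneg[OF assms]])+

text \<open>Complex semidefiniteness is read off from the real form directly, without passing
  through the determinant inequality.\<close>

lemma psd_mat_principal2:
  fixes A :: "complex mat"
  assumes diag: "A $$ (k, k) = complex_of_real r" "A $$ (m, m) = complex_of_real t"
    and off: "A $$ (k, m) = Complex C S" "A $$ (m, k) = Complex C (- S)"
    and form: "\<And>x1 y1 x2 y2. 0 \<le> r * (x1\<^sup>2 + y1\<^sup>2) + t * (x2\<^sup>2 + y2\<^sup>2)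
      + 2 * (C * (x1 * x2 + y1 * y2) + S * (x1 * y2 - y1 * x2))"
  shows "psd_mat (principal2 A k m)"
proof -
  let ?P = "principal2 A k m"
  have P: "?P \<in> carrier_mat 2 2"
    by (auto simp: principal2_def mat_of_rows_list_def)
  have entries: "?P $$ (0, 0) = complex_of_real r" "?P $$ (1, 1) = complex_of_real t"
      "?P $$ (0, 1) = Complex C S" "?P $$ (1, 0) = Complex C (- S)"
    by (simp_all add: principal2_def mat_of_rows_list_def diag off)
  have "mat_adjoint ?P = ?P"
  proof (rule eq_matI)
    fix i j assume "i < dim_row ?P" "j < dim_col ?P"
    with P have "i \<in> {0, 1}" "j \<in> {0, 1}" by auto
    with P show "mat_adjoint ?P $$ (i, j) = ?P $$ (i, j)"
      by (auto simp: mat_adjoint_def mat_of_rows_index entries complex_eq_iff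
          entries[unfolded One_nat_def])
  qed (use P in \<open>auto simp: mat_adjoint_def\<close>)
  moreover have "0 \<le> (?P *\<^sub>v v) \<bullet>c v" if v: "v \<in> carrier_vec 2" for v
  proof -
    have two: "{0..<2} = {0, 1 :: nat}" by auto
    have "(?P *\<^sub>v v) \<bullet>c v =
        (complex_of_real r * v $ 0 + Complex C S * v $ 1) * cnj (v $ 0)
        + (Complex C (- S) * v $ 0 + complex_of_real t * v $ 1) * cnj (v $ 1)"
      using P v by (simp add: scalar_prod_def two entries entries[unfolded One_nat_def])
    \<comment> \<open>The two off-diagonal terms are conjugate to each other, so the value is real.
      It equals the real form at the conjugate of \<open>v\<close>, since conjugation flips the sign
      of the \<open>S\<close> term; hence the negated imaginary parts.\<close>
    moreover have "0 \<le> \<dots>"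
      using form[of "Re (v $ 0)" "- Im (v $ 0)" "Re (v $ 1)" "- Im (v $ 1)"]
      by (simp add: less_eq_complex_def power2_eq_square algebra_simps)
    ultimately show ?thesis by simp
  qed
  ultimately show ?thesis
    using P by (auto simp: psd_mat_def)
qed

theorem mainTheorem3:
  fixes n :: nat and W :: "real mat" and k m :: nat
  assumes W: "W \<in> carrier_mat (2 * n) (2 * n)"
    and sym: "W\<^sup>T = W"
    and k: "k < n" and m: "m < n" and km: "k \<noteq> m"
    and psd: "psd_mat W"
  shows "psd_mat (principal2 (herm_of n W) k m) \<and>
         0 \<le> herm_of n W $$ (k, k) \<and>
         0 \<le> herm_of n W $$ (m, m) \<and>
         (Re (herm_of n W $$ (k, m)))\<^sup>2 + (Im (herm_of n W $$ (k, m)))\<^sup>2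
         \<le> Re (herm_of n W $$ (k, k)) * Re (herm_of n W $$ (m, m)) \<and>
         (W $$ (k, m) + W $$ (n + k, n + m))\<^sup>2 + (W $$ (m, n + k) - W $$ (k, n + m))\<^sup>2
         \<le> (W $$ (k, k) + W $$ (n + k, n + k)) * (W $$ (m, m) + W $$ (n + m, n + m)) \<and>
         (\<forall>\<sigma>. \<sigma> permutes {k, m, n + k, n + m} \<longrightarrow>
           (let c = W $$ (\<sigma> k, \<sigma> m) + W $$ (\<sigma> (n + k), \<sigma> (n + m));
                s = W $$ (\<sigma> k, \<sigma> (n + m)) - W $$ (\<sigma> m, \<sigma> (n + k));
                r = W $$ (\<sigma> k, \<sigma> k) + W $$ (\<sigma> (n + k), \<sigma> (n + k));
                t = W $$ (\<sigma> m, \<sigma> m) + W $$ (\<sigma> (n + m), \<sigma> (n + m))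
            in c\<^sup>2 + s\<^sup>2 \<le> r * t))"
proof -
  have s: "W $$ (i, j) = W $$ (j, i)" if "i < 2 * n" "j < 2 * n" for i j
    using W sym that by (metis carrier_matD index_transpose_mat(1))
  define X where "X = herm_of n W"
  define r where "r = W $$ (k, k) + W $$ (n + k, n + k)"
  define t where "t = W $$ (m, m) + W $$ (n + m, n + m)"
  define C where "C = W $$ (k, m) + W $$ (n + k, n + m)"
  define S where "S = W $$ (k, n + m) - W $$ (m, n + k)"
  \<comment> \<open>These equate the real parts of the two off-diagonal entries of \<open>X\<close>;
    the imaginary part changes sign under exchange of \<open>k\<close> and \<open>m\<close> by its
    definition.\<close>
  have comm: "W $$ (m, k) = W $$ (k, m)" "W $$ (n + m, n + k) = W $$ (n + k, n + m)"
    using k m by (auto intro: s)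
  have X: "X $$ (k, k) = complex_of_real r" "X $$ (m, m) = complex_of_real t"
      "X $$ (k, m) = Complex C S" "X $$ (m, k) = Complex C (- S)"
    using k m km by (simp_all add: X_def herm_of_def r_def t_def C_def S_def comm)
  have lt: "{k, m, n + k, n + m} \<subseteq> {..<2 * n}" and dist: "distinct [k, m, n + k, n + m]"
    using k m km by auto
  have "psd_mat (principal2 X k m)"
    by (rule psd_mat_principal2[OF X])
      (unfold r_def t_def C_def S_def, rule psd_mat_hermitian_form_nonneg[OF W sym psd lt dist])
  moreover have "0 \<le> r" "0 \<le> t" "C\<^sup>2 + S\<^sup>2 \<le> r * t"
    unfolding r_def t_def C_def S_def
    by (rule psd_mat_imp_discriminant_le[OF W sym psd lt dist])+
  moreover have "(W $$ (m, n + k) - W $$ (k, n + m))\<^sup>2 = S\<^sup>2"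
    by (simp add: S_def power2_commute)
  \<comment> \<open>The same bound at the images of the four indices: they stay in range because
    \<open>\<sigma>\<close> maps the set onto itself, and distinct because it is injective.\<close>
  moreover have "(W $$ (\<sigma> k, \<sigma> m) + W $$ (\<sigma> (n + k), \<sigma> (n + m)))\<^sup>2
        + (W $$ (\<sigma> k, \<sigma> (n + m)) - W $$ (\<sigma> m, \<sigma> (n + k)))\<^sup>2
      \<le> (W $$ (\<sigma> k, \<sigma> k) + W $$ (\<sigma> (n + k), \<sigma> (n + k)))
        * (W $$ (\<sigma> m, \<sigma> m) + W $$ (\<sigma> (n + m), \<sigma> (n + m)))"
    if \<sigma>: "\<sigma> permutes {k, m, n + k, n + m}" for \<sigma>
  proof (rule psd_mat_imp_discriminant_le(3)[OF W sym psd])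
    have "\<sigma> ` {k, m, n + k, n + m} \<subseteq> {..<2 * n}"
      using permutes_image[OF \<sigma>] lt by simp
    then show "{\<sigma> k, \<sigma> m, \<sigma> (n + k), \<sigma> (n + m)} \<subseteq> {..<2 * n}" by simp
    show "distinct [\<sigma> k, \<sigma> m, \<sigma> (n + k), \<sigma> (n + m)]"
      using dist by (simp add: inj_eq[OF permutes_inj[OF \<sigma>]])
  qed
  ultimately show ?thesis
    unfolding X_def[symmetric] X Let_def r_def[symmetric] t_def[symmetric] C_def[symmetric]
    by (simp add: less_eq_complex_def)
qed

end
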